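(* Let $X$ and $Y$ be independent real random variables with log-concave densities $f_X$ and $f_Y$ on $\mathbb{R}$. Let $\Phi:\mathbb{R}^2\to\mathbb{R}$ be a (Borel measurable) function that is coordinatewise non-decreasing, such that the conditional expectation $$g(z)\equiv E\{\Phi(X,Y)\mid X+Y=z\}$$ is well defined. Then $g$ is non-decreasing in $z$.
   Context: A density $f$ on $\mathbb{R}$ is log-concave if $f=e^{-\varphi}$ with $\varphi:\mathbb{R}\to(-\infty,\infty]$ convex. Coordinatewise non-decreasing means non-decreasing in each of the two arguments when the other is held fixed. The conditional expectation is given by densities: with $N(z)=\int_{\mathbb{R}}f_X(z-y)f_Y(y)\,dy$, $$E\{\Phi(X,Y)\mid X+Y=z\}=\int_{\mathbb{R}}\Phi(z-y,y)\,\frac{f_X(z-y)f_Y(y)}{N(z)}\,dy ,$$ considered at the points $z$ with $N(z)>0$; "well defined" means that this integral is absolutely convergent at all such $z$. *)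

theory Defs
  imports "HOL-Probability.Probability"
begin

text \<open>The library's notion of convexity on a set is for real-valued functions only. Here the
value \<open>\<infinity>\<close> is allowed; the convention \<open>0 * \<infinity> = 0\<close> on the extended reals makes
the inequality trivial for weights \<open>0\<close> and \<open>1\<close>.\<close>

definition convex_ereal :: "(real \<Rightarrow> ereal) \<Rightarrow> bool" where
  "convex_ereal \<phi> \<longleftrightarrow>
     (\<forall>x y u v. 0 \<le> u \<longrightarrow> 0 \<le> v \<longrightarrow> u + v = 1 \<longrightarrow>
        \<phi> (u * x + v * y) \<le> ereal u * \<phi> x + ereal v * \<phi> y)"

text \<open>\<open>exp_neg t\<close> is \<open>e\<^sup>-\<^sup>t\<close> for \<open>t\<close> in \<open>(-\<infinity>, \<infinity>]\<close>;
the value at \<open>-\<infinity>\<close> is irrelevant.\<close>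

definition exp_neg :: "ereal \<Rightarrow> real" where
  "exp_neg t = (if t = \<infinity> then 0 else exp (- real_of_ereal t))"

definition log_concave :: "(real \<Rightarrow> real) \<Rightarrow> bool" where
  "log_concave f \<longleftrightarrow>
     (\<exists>\<phi>. (\<forall>x. \<phi> x \<noteq> -\<infinity>) \<and> convex_ereal \<phi> \<and> (\<forall>x. f x = exp_neg (\<phi> x)))"

definition sum_density :: "(real \<Rightarrow> real) \<Rightarrow> (real \<Rightarrow> real) \<Rightarrow> real \<Rightarrow> real" where
  "sum_density f\<^sub>X f\<^sub>Y z = (LINT y|lborel. f\<^sub>X (z - y) * f\<^sub>Y y)"

definition cond_integrand ::
  "(real \<times> real \<Rightarrow> real) \<Rightarrow> (real \<Rightarrow> real) \<Rightarrow> (real \<Rightarrow> real) \<Rightarrow> real \<Rightarrow> real \<Rightarrow> real" where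
  "cond_integrand \<Phi> f\<^sub>X f\<^sub>Y z y =
     \<Phi> (z - y, y) * (f\<^sub>X (z - y) * f\<^sub>Y y / sum_density f\<^sub>X f\<^sub>Y z)"

text \<open>The version of \<open>E(\<Phi>(X,Y) | X + Y = z)\<close> given by the densities; meaningful only at
points \<open>z\<close> where \<open>sum_density f\<^sub>X f\<^sub>Y z\<close> is positive.\<close>

definition cond_expect_sum ::
  "(real \<times> real \<Rightarrow> real) \<Rightarrow> (real \<Rightarrow> real) \<Rightarrow> (real \<Rightarrow> real) \<Rightarrow> real \<Rightarrow> real" where
  "cond_expect_sum \<Phi> f\<^sub>X f\<^sub>Y z = (LINT y|lborel. cond_integrand \<Phi> f\<^sub>X f\<^sub>Y z y)"

definition cond_expect_sum_well_defined ::
  "(real \<times> real \<Rightarrow> real) \<Rightarrow> (real \<Rightarrow> real) \<Rightarrow> (real \<Rightarrow> real) \<Rightarrow> bool" where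
  "cond_expect_sum_well_defined \<Phi> f\<^sub>X f\<^sub>Y \<longleftrightarrow>
     (\<forall>z. sum_density f\<^sub>X f\<^sub>Y z > 0 \<longrightarrow> integrable lborel (cond_integrand \<Phi> f\<^sub>X f\<^sub>Y z))"

definition coordinatewise_mono :: "(real \<times> real \<Rightarrow> real) \<Rightarrow> bool" where
  "coordinatewise_mono \<Phi> \<longleftrightarrow> (\<forall>y. mono (\<lambda>x. \<Phi> (x, y))) \<and> (\<forall>x. mono (\<lambda>y. \<Phi> (x, y)))"

end

theory Submission
  imports Defs
begin

text \<open>
  Fix \<open>z\<^sub>1 \<le> z\<^sub>2\<close> with \<open>N(z\<^sub>i) > 0\<close> and let \<open>p\<^sub>i(y) = f\<^sub>X(z\<^sub>i - y) f\<^sub>Y(y) / N(z\<^sub>i)\<close> be the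
  conditional density of \<open>Y\<close> given \<open>X + Y = z\<^sub>i\<close>. The proof couples the two conditional laws so that
  both coordinates are ordered: on one probability space there are \<open>Y\<^sub>1 \<le> Y\<^sub>2\<close> with densities
  \<open>p\<^sub>1\<close>, \<open>p\<^sub>2\<close> such that also \<open>z\<^sub>1 - Y\<^sub>1 \<le> z\<^sub>2 - Y\<^sub>2\<close>. Then
  \<open>\<Phi>(z\<^sub>1 - Y\<^sub>1, Y\<^sub>1) \<le> \<Phi>(z\<^sub>2 - Y\<^sub>2, Y\<^sub>2)\<close> holds pointwise, and taking expectations gives the claim.

  The coupling is the quantile coupling \<open>Y\<^sub>i = F\<^sub>i\<inverse>(U)\<close>, with \<open>U\<close> uniform on \<open>(0, 1)\<close> and
  \<open>F\<^sub>i\<close> the distribution function of \<open>p\<^sub>i\<close>; for it the two orderings amount to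
  \<open>F\<^sub>2(t) \<le> F\<^sub>1(t) \<le> F\<^sub>2(t + z\<^sub>2 - z\<^sub>1)\<close> for all \<open>t\<close> (\<open>quantile_between\<close>). Each of these
  inequalities follows from a monotone likelihood ratio (\<open>likelihood_ratio_order\<close>), and each of the
  likelihood ratios is monotone because of the log-concavity of one of the factors: up to the constants \<open>N(z\<^sub>i)\<close>, between \<open>p\<^sub>1(y)\<close>
  and \<open>p\<^sub>2(y)\<close> only the argument of \<open>f\<^sub>X\<close> changes, and between \<open>p\<^sub>1(y)\<close> and
  \<open>p\<^sub>2(y + z\<^sub>2 - z\<^sub>1)\<close> only the argument of \<open>f\<^sub>Y\<close> does. In either case \<open>log_concave_exchange\<close>
  is exactly what is needed.
\<close>

lemma log_concave_nonneg: "log_concave f \<Longrightarrow> 0 \<le> f x"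
  by (auto simp: log_concave_def exp_neg_def)

text \<open>
  The points \<open>a + d\<close> and \<open>b\<close> lie between \<open>a\<close> and \<open>b + d\<close>, and they are convex combinations of these
  two with interchanged weights. Adding the two convexity inequalities for \<open>- ln f\<close> makes the
  weights disappear. In other words, the kernel \<open>(x, y) \<mapsto> f (x - y)\<close> is totally positive of order 2.
\<close>

lemma log_concave_exchange:
  fixes f :: "real \<Rightarrow> real"
  assumes f: "log_concave f" and ab: "a \<le> b" and d: "0 \<le> d"
  shows "f a * f (b + d) \<le> f (a + d) * f b"
proof -
  obtain \<phi> where ninf: "\<And>x. \<phi> x \<noteq> -\<infinity>" and conv: "convex_ereal \<phi>"
    and f_eq: "\<And>x. f x = exp_neg (\<phi> x)"
    using f unfolding log_concave_def by blast
  consider "f a = 0 \<or> f (b + d) = 0" | "b - a + d = 0"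
    | "f a \<noteq> 0" "f (b + d) \<noteq> 0" "0 < b - a + d"
    using ab d by linarith
  then show ?thesis
  proof cases
    case 1
    then show ?thesis
      using log_concave_nonneg[OF f] by auto
  next
    case 2
    then have "b = a" "d = 0" using ab d by auto
    then show ?thesis by simp
  next
    case 3
    obtain r where r: "\<phi> a = ereal r"
      using 3(1) ninf[of a] by (cases "\<phi> a") (auto simp: f_eq exp_neg_def)
    obtain s where s: "\<phi> (b + d) = ereal s"
      using 3(2) ninf[of "b + d"] by (cases "\<phi> (b + d)") (auto simp: f_eq exp_neg_def)
    define l where "l = d / (b - a + d)"
    have l: "0 \<le> l" "0 \<le> 1 - l"
      using 3 ab d by (auto simp: l_def field_simps)
    have ld: "l * (b - a + d) = d"
      using 3(3) by (simp add: l_def)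
    have pts: "a + d = (1 - l) * a + l * (b + d)" "b = l * a + (1 - l) * (b + d)"
      using ld by (simp_all add: algebra_simps)
    have A: "\<phi> (a + d) \<le> ereal ((1 - l) * r + l * s)"
      using conv[unfolded convex_ereal_def, rule_format, of "1 - l" l a "b + d"] l
      by (simp add: r s pts(1)[symmetric])
    have B: "\<phi> b \<le> ereal (l * r + (1 - l) * s)"
      using conv[unfolded convex_ereal_def, rule_format, of l "1 - l" a "b + d"] l
      by (simp add: r s pts(2)[symmetric])
    obtain u where u: "\<phi> (a + d) = ereal u"
      using A ninf[of "a + d"] by (cases "\<phi> (a + d)") auto
    obtain v where v: "\<phi> b = ereal v"
      using B ninf[of b] by (cases "\<phi> b") auto
    have "u + v \<le> ((1 - l) * r + l * s) + (l * r + (1 - l) * s)"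
      using A B u v by simp
    also have "\<dots> = r + s" by (simp add: algebra_simps)
    finally show ?thesis
      by (simp add: f_eq r s u v exp_neg_def flip: exp_add)
  qed
qed

text \<open>
  Integrating the cross inequality over \<open>x \<le> t < y\<close> gives
  \<open>P(\<le> t) Q(> t) \<ge> P(> t) Q(\<le> t)\<close>; as the total masses agree, \<open>P(> t) = m - P(\<le> t)\<close> and
  the same for \<open>Q\<close>, so the product \<open>P(\<le> t) Q(\<le> t)\<close> cancels.
\<close>

lemma likelihood_ratio_order:
  fixes p q :: "real \<Rightarrow> real"
  assumes p: "integrable lborel p" and q: "integrable lborel q"
    and mass: "(LINT y|lborel. p y) = m" "(LINT y|lborel. q y) = m" and m: "0 < m"
    and cross: "\<And>x y. x \<le> y \<Longrightarrow> p y * q x \<le> p x * q y"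
  shows "(LINT y:{..t}|lborel. q y) \<le> (LINT y:{..t}|lborel. p y)"
proof -
  have si: "set_integrable lborel A p" "set_integrable lborel A q" if "A \<in> sets borel" for A
    using that p q unfolding set_integrable_def
    by (auto intro!: integrable_mult_indicator simp del: real_scaleR_def)
  have split: "(LINT y|lborel. h y) = (LINT y:{..t}|lborel. h y) + (LINT y:{t<..}|lborel. h y)"
    if "\<And>A. A \<in> sets borel \<Longrightarrow> set_integrable lborel A h" for h :: "real \<Rightarrow> real"
  proof -
    have "(LINT y:UNIV|lborel. h y) = (LINT y:{..t} \<union> {t<..}|lborel. h y)"
      by (rule arg_cong[where f="\<lambda>A. LINT y:A|lborel. h y"]) auto
    also have "\<dots> = (LINT y:{..t}|lborel. h y) + (LINT y:{t<..}|lborel. h y)"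
      using that by (intro set_integral_Un) auto
    finally show ?thesis by (simp add: set_lebesgue_integral_def)
  qed
  define Pl where "Pl = (LINT y:{..t}|lborel. p y)"
  define Pr where "Pr = (LINT y:{t<..}|lborel. p y)"
  define Ql where "Ql = (LINT y:{..t}|lborel. q y)"
  define Qr where "Qr = (LINT y:{t<..}|lborel. q y)"
  have PQ: "Pl + Pr = m" "Ql + Qr = m"
    using split[of p] split[of q] si mass by (auto simp: Pl_def Pr_def Ql_def Qr_def)
  have inner: "Pr * q x \<le> Qr * p x" if "x \<le> t" for x
  proof -
    have "(LINT y:{t<..}|lborel. q x * p y) \<le> (LINT y:{t<..}|lborel. p x * q y)"
      using si that cross[of x]
      by (intro set_integral_mono set_integrable_mult_right) (auto simp: mult.commute)
    then show ?thesis by (simp add: Pr_def Qr_def mult.commute)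
  qed
  have "(LINT x:{..t}|lborel. Pr * q x) \<le> (LINT x:{..t}|lborel. Qr * p x)"
    using si inner by (intro set_integral_mono set_integrable_mult_right) auto
  then have "Pr * Ql \<le> Qr * Pl" by (simp add: Pl_def Ql_def)
  moreover have "Pr = m - Pl" "Qr = m - Ql" using PQ by auto
  ultimately have "m * Ql \<le> m * Pl" by (simp add: algebra_simps)
  then show ?thesis using m by (simp add: Pl_def Ql_def)
qed

text \<open>
  A quantile is characterized by \<open>u \<le> F(x) \<longleftrightarrow> F\<inverse>(u) \<le> x\<close>, so bounds between distribution functions
  turn into reversed bounds between quantile functions, and a shift of the argument into a summand.
\<close>

lemma quantile_between:
  assumes M: "real_distribution M" and N: "real_distribution N"
    and lower: "\<And>t. cdf N t \<le> cdf M t" and upper: "\<And>t. cdf M t \<le> cdf N (t + d)"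
    and u: "0 < u" "u < 1"
  shows "Inf {x. u \<le> cdf M x} \<le> Inf {x. u \<le> cdf N x}"
    and "Inf {x. u \<le> cdf N x} \<le> Inf {x. u \<le> cdf M x} + d"
proof -
  interpret M: cdf_distribution M unfolding cdf_distribution_def by (rule M)
  interpret N: cdf_distribution N unfolding cdf_distribution_def by (rule N)
  have "u \<le> cdf N (N.I u)" using N.pseudoinverse[OF u] by blast
  then show "M.I u \<le> N.I u"
    using M.pseudoinverse[OF u] lower order_trans by blast
  have "u \<le> cdf M (M.I u)" using M.pseudoinverse[OF u] by blast
  then show "N.I u \<le> M.I u + d"
    using N.pseudoinverse[OF u] upper order_trans by blast
qed

text \<open>
  The quantile functions, evaluated at a uniformly distributed point of the unit interval, realize
  both laws on one space.
\<close>

lemma integral_mono_quantile_coupling: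
  fixes h k :: "real \<Rightarrow> real"
  assumes M: "real_distribution M" and N: "real_distribution N"
    and lower: "\<And>t. cdf N t \<le> cdf M t" and upper: "\<And>t. cdf M t \<le> cdf N (t + d)"
    and h: "integrable M h" and k: "integrable N k"
    and le: "\<And>x y. x \<le> y \<Longrightarrow> y \<le> x + d \<Longrightarrow> h x \<le> k y"
  shows "(LINT x|M. h x) \<le> (LINT x|N. k x)"
proof -
  interpret M: cdf_distribution M unfolding cdf_distribution_def by (rule M)
  interpret N: cdf_distribution N unfolding cdf_distribution_def by (rule N)
  let ?U = "restrict_space lborel {0<..<1::real}"
  have meas: "M.I \<in> measurable ?U borel" "N.I \<in> measurable ?U borel"
    using M.measurable_CI N.measurable_CI
    by (simp_all cong: measurable_cong_sets sets_restrict_space_cong)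
  have hk: "h \<in> borel_measurable borel" "k \<in> borel_measurable borel"
    using h k by (auto dest!: borel_measurable_integrable)
  have "(LINT x|M. h x) = (LINT u|?U. h (M.I u))"
    using meas hk by (subst M.distr_I_eq_M[symmetric]) (rule integral_distr)
  also have "\<dots> \<le> (LINT u|?U. k (N.I u))"
  proof (rule integral_mono)
    show "integrable ?U (\<lambda>u. h (M.I u))"
      using h meas(1) by (subst (asm) M.distr_I_eq_M[symmetric]) (rule integrable_distr)
    show "integrable ?U (\<lambda>u. k (N.I u))"
      using k meas(2) by (subst (asm) N.distr_I_eq_M[symmetric]) (rule integrable_distr)
    fix u assume "u \<in> space ?U"
    then have "0 < u" "u < 1" by (auto simp: space_restrict_space)
    then show "h (M.I u) \<le> k (N.I u)"
      using quantile_between[OF M N lower upper] by (intro le) auto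
  qed
  also have "\<dots> = (LINT x|N. k x)"
    using meas hk by (subst (2) N.distr_I_eq_M[symmetric]) (rule integral_distr[symmetric])
  finally show ?thesis .
qed

lemma real_distribution_density:
  fixes p :: "real \<Rightarrow> real"
  assumes p: "integrable lborel p" "\<And>x. 0 \<le> p x" "(LINT x|lborel. p x) = 1"
  shows "real_distribution (density lborel p)"
proof -
  have [measurable]: "p \<in> borel_measurable borel"
    using p(1) by (auto dest: borel_measurable_integrable)
  have "prob_space (density lborel p)"
  proof
    show "emeasure (density lborel p) (space (density lborel p)) = 1"
      using p by (simp add: emeasure_density nn_integral_eq_integral)
  qed
  then show ?thesis
    by (simp add: real_distribution_def real_distribution_axioms_def)
qed

lemma cdf_density:
  fixes p :: "real \<Rightarrow> real"
  assumes p: "integrable lborel p" "\<And>x. 0 \<le> p x"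
  shows "cdf (density lborel p) t = (LINT x:{..t}|lborel. p x)"
proof -
  have [measurable]: "p \<in> borel_measurable borel"
    using p(1) by (auto dest: borel_measurable_integrable)
  have "emeasure (density lborel p) {..t} = (\<integral>\<^sup>+x. ennreal (indicator {..t} x * p x) \<partial>lborel)"
    by (subst emeasure_density) (auto intro!: nn_integral_cong simp: indicator_def)
  also have "\<dots> = ennreal (LINT x:{..t}|lborel. p x)"
    using integrable_mult_indicator[OF _ p(1), of "{..t}"] p(2)
    by (subst nn_integral_eq_integral) (auto simp: set_lebesgue_integral_def)
  finally show ?thesis
    using p(2)
    by (simp add: cdf_def measure_def set_lebesgue_integral_def integral_nonneg_AE)
qed

theorem theorem6p8:
  fixes M :: "'a measure" and X Y :: "'a \<Rightarrow> real"
    and f\<^sub>X f\<^sub>Y :: "real \<Rightarrow> real" and \<Phi> :: "real \<times> real \<Rightarrow> real"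
  assumes "prob_space M"
    and "prob_space.indep_var M borel X borel Y"
    and "distributed M lborel X (\<lambda>x. ennreal (f\<^sub>X x))"
    and "distributed M lborel Y (\<lambda>y. ennreal (f\<^sub>Y y))"
    and "log_concave f\<^sub>X" and "log_concave f\<^sub>Y"
    and "\<Phi> \<in> borel_measurable borel"
    and "coordinatewise_mono \<Phi>"
    and "cond_expect_sum_well_defined \<Phi> f\<^sub>X f\<^sub>Y"
  shows "mono_on {z. sum_density f\<^sub>X f\<^sub>Y z > 0} (cond_expect_sum \<Phi> f\<^sub>X f\<^sub>Y)"
proof (rule mono_onI)
  note fX = \<open>log_concave f\<^sub>X\<close> and fY = \<open>log_concave f\<^sub>Y\<close>
  have [measurable]: "\<Phi> \<in> borel_measurable borel" by fact
  fix z w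
  assume z: "z \<in> {z. sum_density f\<^sub>X f\<^sub>Y z > 0}" and w: "w \<in> {z. sum_density f\<^sub>X f\<^sub>Y z > 0}"
    and zw: "z \<le> w"
  define N where "N = sum_density f\<^sub>X f\<^sub>Y"
  define p where "p = (\<lambda>c y. f\<^sub>X (c - y) * f\<^sub>Y y / N c)"
  define K where "K = (\<lambda>c. density lborel (p c))"
  have Nz: "0 < N z" and Nw: "0 < N w" using z w by (auto simp: N_def)

  have p_nonneg: "0 \<le> p c y" if "0 < N c" for c y
    using that log_concave_nonneg[OF fX] log_concave_nonneg[OF fY] by (simp add: p_def)
  have p_int: "integrable lborel (p c)" if "0 < N c" for c
  proof -
    \<comment> \<open>A function that is not integrable has integral \<open>0\<close>.\<close>
    have "integrable lborel (\<lambda>y. f\<^sub>X (c - y) * f\<^sub>Y y)"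
      using that not_integrable_integral_eq by (force simp: N_def sum_density_def)
    then show ?thesis by (simp add: p_def)
  qed
  have p_mass: "(LINT y|lborel. p c y) = 1" if "0 < N c" for c
    using that by (simp add: p_def N_def sum_density_def)
  have K: "real_distribution (K c)" and K_cdf: "cdf (K c) t = (LINT y:{..t}|lborel. p c y)"
    if "0 < N c" for c t
    unfolding K_def using that
    by (intro real_distribution_density cdf_density p_int p_nonneg p_mass; assumption)+

  have p_meas: "p c \<in> borel_measurable lborel" if "0 < N c" for c
    using p_int[OF that] by (rule borel_measurable_integrable)
  have K_int: "integrable (K c) (\<lambda>y. \<Phi> (c - y, y))"
    and K_expect: "cond_expect_sum \<Phi> f\<^sub>X f\<^sub>Y c = (LINT y|K c. \<Phi> (c - y, y))"
    if "0 < N c" for c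
  proof -
    have eq: "cond_integrand \<Phi> f\<^sub>X f\<^sub>Y c y = p c y *\<^sub>R \<Phi> (c - y, y)" for y
      by (simp add: cond_integrand_def p_def N_def)
    have m: "(\<lambda>y. \<Phi> (c - y, y)) \<in> borel_measurable lborel"
      by measurable
    show "integrable (K c) (\<lambda>y. \<Phi> (c - y, y))"
      using assms(9) that p_nonneg[OF that] unfolding K_def
      by (subst integrable_density[OF m p_meas[OF that]])
         (auto simp: cond_expect_sum_well_defined_def N_def eq[abs_def] simp del: real_scaleR_def)
    show "cond_expect_sum \<Phi> f\<^sub>X f\<^sub>Y c = (LINT y|K c. \<Phi> (c - y, y))"
      using p_nonneg[OF that] unfolding K_def
      by (subst integral_density[OF m p_meas[OF that]])
         (auto simp: cond_expect_sum_def eq[abs_def] simp del: real_scaleR_def)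
  qed

  have lower: "cdf (K w) t \<le> cdf (K z) t" for t
    unfolding K_cdf[OF Nz] K_cdf[OF Nw]
  proof (rule likelihood_ratio_order[where m=1])
    fix x y :: real assume "x \<le> y"
    then have "f\<^sub>X (z - y) * f\<^sub>X (w - x) \<le> f\<^sub>X (w - y) * f\<^sub>X (z - x)"
      using log_concave_exchange[OF fX, of "z - y" "z - x" "w - z"] zw by simp
    then have "(f\<^sub>X (z - y) * f\<^sub>X (w - x)) * (f\<^sub>Y x * f\<^sub>Y y / (N z * N w))
        \<le> (f\<^sub>X (w - y) * f\<^sub>X (z - x)) * (f\<^sub>Y x * f\<^sub>Y y / (N z * N w))"
      using Nz Nw log_concave_nonneg[OF fY] by (intro mult_right_mono) auto
    then show "p z y * p w x \<le> p z x * p w y"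
      by (simp add: p_def mult_ac)
  qed (use p_int p_mass Nz Nw in auto)

  \<comment> \<open>The shift by \<open>w - z\<close> gives the density of \<open>Y - (w - z)\<close> under the law \<open>K w\<close>; there the
    factor \<open>f\<^sub>X\<close> is evaluated at \<open>z - y\<close>, just as in \<open>p z y\<close>.\<close>
  define q where "q = (\<lambda>y. p w ((w - z) + 1 * y))"
  have q_int: "integrable lborel q" and q_mass: "(LINT y|lborel. q y) = 1"
    using lborel_integrable_real_affine[OF p_int[OF Nw], of 1 "w - z"]
      lborel_integral_real_affine[of 1 "p w" "w - z"] p_mass[OF Nw] by (simp_all add: q_def)
  have q_set: "(LINT y:{..t}|lborel. q y) = (LINT y:{..t + (w - z)}|lborel. p w y)" for t
    unfolding set_lebesgue_integral_def q_def
    by (subst (2) lborel_integral_real_affine[of 1 _ "w - z"])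
       (auto intro!: Bochner_Integration.integral_cong simp: indicator_def)
  have upper: "cdf (K z) t \<le> cdf (K w) (t + (w - z))" for t
    unfolding K_cdf[OF Nz] K_cdf[OF Nw] q_set[symmetric]
  proof (rule likelihood_ratio_order[where m=1])
    fix x y :: real assume "x \<le> y"
    then have "f\<^sub>Y x * f\<^sub>Y (y + (w - z)) \<le> f\<^sub>Y (x + (w - z)) * f\<^sub>Y y"
      using log_concave_exchange[OF fY, of x y "w - z"] zw by simp
    then have "(f\<^sub>Y x * f\<^sub>Y (y + (w - z))) * (f\<^sub>X (z - x) * f\<^sub>X (z - y) / (N z * N w))
        \<le> (f\<^sub>Y (x + (w - z)) * f\<^sub>Y y) * (f\<^sub>X (z - x) * f\<^sub>X (z - y) / (N z * N w))"
      using Nz Nw log_concave_nonneg[OF fX] by (intro mult_right_mono) auto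
    moreover have "q v = f\<^sub>X (z - v) * f\<^sub>Y (v + (w - z)) / N w" for v
      by (simp add: q_def p_def add.commute diff_diff_eq)
    ultimately show "q y * p z x \<le> q x * p z y"
      by (simp add: p_def mult_ac)
  qed (use p_int p_mass q_int q_mass Nz in auto)

  show "cond_expect_sum \<Phi> f\<^sub>X f\<^sub>Y z \<le> cond_expect_sum \<Phi> f\<^sub>X f\<^sub>Y w"
    unfolding K_expect[OF Nz] K_expect[OF Nw]
  proof (rule integral_mono_quantile_coupling[OF K[OF Nz] K[OF Nw] lower upper])
    fix x y :: real assume "x \<le> y" "y \<le> x + (w - z)"
    then have "\<Phi> (z - x, x) \<le> \<Phi> (w - y, x)" "\<Phi> (w - y, x) \<le> \<Phi> (w - y, y)"
      using assms(8) by (auto simp: coordinatewise_mono_def mono_def)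
    then show "\<Phi> (z - x, x) \<le> \<Phi> (w - y, y)" by (rule order_trans)
  qed (use K_int Nz Nw in auto)
qed

end
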